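(* Let $G$ be a connected graph of order at least $3$ having $k$ pendants. If $G$ is not $K_2$, then $\chi_{la}(G)\ge k+1$, and the bound is sharp.
   Context: A pendant is a vertex of degree $1$. A local antimagic labeling of a connected graph $G=(V,E)$ is a bijection $f:E\to\{1,\dots,|E|\}$ such that, with $f^+(u)=\sum f(e)$ (sum over all edges $e$ incident to $u$), one has $f^+(u)\neq f^+(v)$ for every pair of adjacent vertices $u,v$. The color number $c(f)$ is the number of distinct values of $f^+$ on $V$. The local antimagic chromatic number $\chi_{la}(G)$ is the minimum of $c(f)$ over all local antimagic labelings $f$ of $G$. *)

theory Defs
  imports Main "HOL-Library.Extended_Nat"
begin

text \<open>A finite simple graph is given by its vertex set \<open>V\<close> and its set \<open>E\<close> of
  two-element edges.\<close>

definition simple_graph :: "'a set \<Rightarrow> 'a set set \<Rightarrow> bool" where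
  "simple_graph V E \<longleftrightarrow> finite V \<and> E \<subseteq> {{u, v} | u v. u \<in> V \<and> v \<in> V \<and> u \<noteq> v}"

definition connected_graph :: "'a set \<Rightarrow> 'a set set \<Rightarrow> bool" where
  "connected_graph V E \<longleftrightarrow>
     simple_graph V E \<and> V \<noteq> {} \<and> (\<forall>u\<in>V. \<forall>v\<in>V. (u, v) \<in> {(x, y). {x, y} \<in> E}\<^sup>*)"

definition is_K2 :: "'a set \<Rightarrow> 'a set set \<Rightarrow> bool" where
  "is_K2 V E \<longleftrightarrow> (\<exists>u v. u \<noteq> v \<and> V = {u, v} \<and> E = {{u, v}})"

definition incident_edges :: "'a set set \<Rightarrow> 'a \<Rightarrow> 'a set set" where
  "incident_edges E u = {e \<in> E. u \<in> e}"

definition vertex_degree :: "'a set set \<Rightarrow> 'a \<Rightarrow> nat" where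
  "vertex_degree E u = card (incident_edges E u)"

definition pendants :: "'a set \<Rightarrow> 'a set set \<Rightarrow> 'a set" where
  "pendants V E = {u \<in> V. vertex_degree E u = 1}"

definition induced_color :: "'a set set \<Rightarrow> ('a set \<Rightarrow> nat) \<Rightarrow> 'a \<Rightarrow> nat" where
  "induced_color E f u = (\<Sum>e\<in>incident_edges E u. f e)"

definition local_antimagic :: "'a set \<Rightarrow> 'a set set \<Rightarrow> ('a set \<Rightarrow> nat) \<Rightarrow> bool" where
  "local_antimagic V E f \<longleftrightarrow>
     bij_betw f E {1..card E} \<and>
     (\<forall>u\<in>V. \<forall>v\<in>V. {u, v} \<in> E \<longrightarrow> induced_color E f u \<noteq> induced_color E f v)"

definition color_number :: "'a set \<Rightarrow> 'a set set \<Rightarrow> ('a set \<Rightarrow> nat) \<Rightarrow> nat" where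
  "color_number V E f = card (induced_color E f ` V)"

text \<open>The minimum is taken in \<^typ>\<open>enat\<close>, where every nonempty set attains its infimum.
  The value is \<open>\<infinity>\<close> exactly when there is no local antimagic labeling (as for \<open>K\<^sub>2\<close>);
  an infimum in \<^typ>\<open>nat\<close> would be the meaningless value \<open>0\<close> there.\<close>

definition chi_la :: "'a set \<Rightarrow> 'a set set \<Rightarrow> enat" where
  "chi_la V E = Inf {enat (color_number V E f) | f. local_antimagic V E f}"

end

theory Submission
  imports Defs
begin

text \<open>The colors of the pendants are the labels of their edges, so they are at most \<open>|E|\<close>, and they
  are distinct because a shared edge would join two vertices of the same color. The two ends of the
  edge labeled \<open>|E|\<close> have different colors, both at least \<open>|E|\<close>, so one of them exceeds \<open>|E|\<close> and
  is a color not used by any pendant. The bound is attained by the star \<open>K\<^sub>1\<^sub>,\<^sub>k\<close> for \<open>k \<ge> 2\<close>, and for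
  \<open>k = 1\<close> by \<open>K\<^sub>2\<^sub>,\<^sub>3\<close> with a pendant attached to one vertex of degree 3.\<close>

section \<open>Edges and pendants of simple graphs\<close>

lemma simple_graphI:
  assumes "finite V" and "\<And>e. e \<in> E \<Longrightarrow> e \<subseteq> V \<and> card e = 2"
  shows "simple_graph V E"
  unfolding simple_graph_def
proof (intro conjI subsetI)
  fix e assume "e \<in> E"
  then have "e \<subseteq> V" and "\<exists>u v. e = {u, v} \<and> u \<noteq> v"
    using assms(2) by (simp_all add: card_2_iff)
  then show "e \<in> {{u, v} |u v. u \<in> V \<and> v \<in> V \<and> u \<noteq> v}"
    by auto
qed (rule assms(1))

lemma simple_graph_finite_edges:
  assumes "simple_graph V E"
  shows "finite E"
proof -
  have "finite V" "E \<subseteq> Pow V"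
    using assms by (auto simp: simple_graph_def)
  then show ?thesis
    by (meson finite_Pow_iff finite_subset)
qed

lemma pendant_incident_edgeE:
  assumes "u \<in> pendants V E"
  obtains e where "e \<in> E" "u \<in> e" "incident_edges E u = {e}"
proof -
  have "card (incident_edges E u) = 1"
    using assms by (simp add: pendants_def vertex_degree_def)
  then obtain e where e: "incident_edges E u = {e}"
    by (rule card_1_singletonE)
  then have "e \<in> incident_edges E u"
    by simp
  then have "e \<in> E" "u \<in> e"
    by (simp_all add: incident_edges_def)
  then show ?thesis
    using e by (rule that)
qed

section \<open>The lower bound\<close>

lemma card_pendants_less_color_number:
  assumes G: "simple_graph V E" and "V \<noteq> {}" and f: "local_antimagic V E f"
  shows "card (pendants V E) < color_number V E f"
proof -
  let ?c = "induced_color E f" and ?P = "pendants V E"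
  have fin: "finite E" "finite V" and PV: "?P \<subseteq> V"
    using G simple_graph_finite_edges by (auto simp: simple_graph_def pendants_def)
  have bij: "bij_betw f E {1..card E}"
    and neq: "\<And>u v. u \<in> V \<Longrightarrow> v \<in> V \<Longrightarrow> {u, v} \<in> E \<Longrightarrow> ?c u \<noteq> ?c v"
    using f by (auto simp: local_antimagic_def)
  have edge: "\<exists>u v. u \<in> V \<and> v \<in> V \<and> u \<noteq> v \<and> e = {u, v}" if "e \<in> E" for e
    using G that unfolding simple_graph_def by blast
  have inj: "inj_on ?c ?P"
  proof (rule inj_onI)
    fix p q assume pq: "p \<in> ?P" "q \<in> ?P" "?c p = ?c q"
    obtain d where d: "d \<in> E" "p \<in> d" "incident_edges E p = {d}"
      using pq(1) by (rule pendant_incident_edgeE)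
    obtain e where e: "e \<in> E" "q \<in> e" "incident_edges E q = {e}"
      using pq(2) by (rule pendant_incident_edgeE)
    have "f d = f e"
      using pq(3) d e by (simp add: induced_color_def)
    then have "d = e"
      using bij d e by (auto simp: bij_betw_def dest: inj_onD)
    show "p = q"
    proof (rule ccontr)
      assume "p \<noteq> q"
      then have "d = {p, q}"
        using edge[OF d(1)] d(2) e(2) \<open>d = e\<close> by auto
      then show False
        using neq[of p q] pq d(1) PV by auto
    qed
  qed
  have le: "?c p \<le> card E" if p: "p \<in> ?P" for p
  proof -
    obtain e where "e \<in> E" "incident_edges E p = {e}"
      using p by (rule pendant_incident_edgeE)
    then show ?thesis
      using bij_betwE[OF bij] by (auto simp: induced_color_def)
  qed
  have "\<exists>w\<in>V. ?c w \<notin> ?c ` ?P"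
  \<comment> \<open>Without edges the label range \<open>{1..card E}\<close> is empty and no edge
    carries a largest label; but then there are no pendants either, and any vertex serves as
    \<open>w\<close>.\<close>
  proof (cases "E = {}")
    case True
    then have "?P = {}"
      by (simp add: pendants_def vertex_degree_def incident_edges_def)
    then show ?thesis
      using \<open>V \<noteq> {}\<close> by auto
  next
    case False
    then have "card E \<in> f ` E"
      using bij fin by (auto simp: bij_betw_def Suc_leI card_gt_0_iff)
    then obtain e where e: "e \<in> E" "f e = card E"
      by auto
    obtain u v where uv: "u \<in> V" "v \<in> V" "e = {u, v}"
      using edge[OF e(1)] by auto
    \<comment> \<open>The largest label is one summand of the color of each end of its edge.\<close>
    have ge: "card E \<le> ?c w" if "w \<in> e" for w
      unfolding induced_color_def e(2)[symmetric]
      using e(1) that fin by (intro member_le_sum) (auto simp: incident_edges_def)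
    have "?c u \<noteq> ?c v"
      using neq uv e(1) by auto
    then have "card E < ?c u \<or> card E < ?c v"
      using ge[of u] ge[of v] uv(3) by auto
    then show ?thesis
      using uv le by (metis imageE leD)
  qed
  then have "?c ` ?P \<subset> ?c ` V"
    using PV by blast
  then have "card (?c ` ?P) < card (?c ` V)"
    using fin by (intro psubset_card_mono) auto
  then show ?thesis
    using inj by (simp add: card_image color_number_def)
qed

text \<open>The bound holds for each labeling, hence for the infimum; if no labeling exists, the
  infimum of the empty set is \<open>\<infinity>\<close>.\<close>

lemma chi_la_ge_card_pendants:
  assumes "simple_graph V E" "V \<noteq> {}"
  shows "chi_la V E \<ge> enat (card (pendants V E) + 1)"
  unfolding chi_la_def
proof (rule Inf_greatest)
  fix x
  assume "x \<in> {enat (color_number V E f) |f. local_antimagic V E f}"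
  then show "enat (card (pendants V E) + 1) \<le> x"
    using card_pendants_less_color_number[OF assms] by fastforce
qed

text \<open>By the general bound, a single labeling with few enough colors certifies that an example
  is extremal.\<close>

lemma chi_la_eq_card_pendants:
  assumes "simple_graph V E" "V \<noteq> {}" "local_antimagic V E f"
    and "color_number V E f \<le> card (pendants V E) + 1"
  shows "chi_la V E = enat (card (pendants V E) + 1)"
proof (rule antisym)
  have "chi_la V E \<le> enat (color_number V E f)"
    unfolding chi_la_def using assms(3) by (intro Inf_lower) auto
  also have "\<dots> \<le> enat (card (pendants V E) + 1)"
    using assms(4) by simp
  finally show "chi_la V E \<le> enat (card (pendants V E) + 1)" .
qed (rule chi_la_ge_card_pendants[OF assms(1,2)])

section \<open>Connectedness and incidence in concrete graphs\<close>

text \<open>Adjacency is symmetric, so any two vertices are joined by a walk through the root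
  \<open>r\<close>.\<close>

lemma connected_graphI:
  assumes "simple_graph V E" "r \<in> V"
    and reach: "\<And>v. v \<in> V \<Longrightarrow> (r, v) \<in> {(x, y). {x, y} \<in> E}\<^sup>*"
  shows "connected_graph V E"
proof -
  have "sym ({(x, y). {x, y} \<in> E}\<^sup>*)"
    by (intro sym_rtrancl symI) (auto simp: insert_commute)
  then have "(u, v) \<in> {(x, y). {x, y} \<in> E}\<^sup>*" if "u \<in> V" "v \<in> V" for u v
    using reach[OF that(1)] reach[OF that(2)] by (blast dest: symD intro: rtrancl_trans)
  then show ?thesis
    using assms(1,2) by (auto simp: connected_graph_def)
qed

lemma not_is_K2:
  assumes "card V \<ge> 3"
  shows "\<not> is_K2 V E"
proof
  assume "is_K2 V E"
  then have "card V = 2"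
    by (auto simp: is_K2_def)
  then show False
    using assms by simp
qed

lemma incident_edges_empty: "incident_edges {} u = {}"
  by (simp add: incident_edges_def)

lemma incident_edges_insert:
  "incident_edges (insert e E) u =
    (if u \<in> e then insert e (incident_edges E u) else incident_edges E u)"
  by (auto simp: incident_edges_def)

section \<open>Extremal graphs\<close>

lemma sharp_star:
  fixes k :: nat
  assumes k: "k \<ge> 2"
  shows "\<exists>(V :: nat set) E. connected_graph V E \<and> card V \<ge> 3 \<and> card (pendants V E) = k
    \<and> \<not> is_K2 V E \<and> chi_la V E = enat (k + 1)"
proof -
  define V :: "nat set" where "V = {0..k}"
  define E where "E = (\<lambda>i::nat. {0, i}) ` {1..k}"
  \<comment> \<open>Adding the two ends of an edge gives \<open>{0, i}\<close> the label
    \<open>i\<close>, because the center is \<open>0\<close>.\<close>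
  define f :: "nat set \<Rightarrow> nat" where "f = sum id"
  have inj: "inj_on (\<lambda>i::nat. {0, i}) {1..k}"
    by (auto simp: inj_on_def doubleton_eq_iff)
  have cE: "card E = k"
    unfolding E_def card_image[OF inj] by simp
  have G: "simple_graph V E"
    by (rule simple_graphI) (auto simp: V_def E_def)
  have cV: "card V \<ge> 3"
    using k by (simp add: V_def)
  have conn: "connected_graph V E"
  proof (rule connected_graphI[OF G])
    show "(0, v) \<in> {(x, y). {x, y} \<in> E}\<^sup>*" if "v \<in> V" for v
    proof (cases "v = 0")
      case False
      with that have "{0, v} \<in> E"
        by (auto simp: E_def V_def)
      then show ?thesis
        by auto
    qed simp
  qed (simp add: V_def)
  have leaf: "incident_edges E i = {{0, i}}" if "i \<in> {1..k}" for i
    using that by (auto simp: incident_edges_def E_def)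
  have center: "incident_edges E 0 = E"
    by (auto simp: incident_edges_def E_def)
  have split_V: "V = insert 0 {1..k}"
    by (auto simp: V_def)
  have P: "pendants V E = {1..k}"
    using k by (auto simp: pendants_def vertex_degree_def split_V leaf center cE)
  have f_edge: "f {0, i} = i" if "i \<in> {1..k}" for i
    using that by (simp add: f_def)
  have color_leaf: "induced_color E f i = i" if "i \<in> {1..k}" for i
    using leaf[OF that] f_edge[OF that] by (simp add: induced_color_def)
  have "induced_color E f 0 = \<Sum>{1..k}"
    unfolding induced_color_def center unfolding E_def sum.reindex[OF inj] by (simp add: f_edge)
  \<comment> \<open>Two labels suffice: since \<open>k \<ge> 2\<close>, \<open>k - 1\<close> and
    \<open>k\<close> are distinct labels at the center, and their sum already exceeds
    \<open>k\<close>.\<close>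
  moreover have "\<Sum>{k - 1, k} \<le> \<Sum>{1..k}"
    using k by (intro sum_mono2) auto
  ultimately have color_center: "induced_color E f 0 > k"
    using k by auto
  have "bij_betw f E {1..k}"
    unfolding bij_betw_def inj_on_def by (auto simp: E_def f_edge image_iff)
  moreover have "induced_color E f u \<noteq> induced_color E f v"
    if "{u, v} \<in> E" for u v
  proof -
    have "u = 0 \<and> v \<in> {1..k} \<or> v = 0 \<and> u \<in> {1..k}"
      using that by (auto simp: E_def doubleton_eq_iff)
    then show ?thesis
      using color_center color_leaf[of u] color_leaf[of v] by auto
  qed
  ultimately have la: "local_antimagic V E f"
    by (simp add: local_antimagic_def cE)
  \<comment> \<open>The star has only \<open>k + 1\<close> vertices, so the trivial bound on the
    number of colors is enough.\<close>
  have "color_number V E f \<le> card V"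
    unfolding color_number_def by (rule card_image_le) (simp add: V_def)
  then have "color_number V E f \<le> card (pendants V E) + 1"
    unfolding P by (simp add: V_def)
  moreover have "V \<noteq> {}"
    by (simp add: V_def)
  ultimately have "chi_la V E = enat (card (pendants V E) + 1)"
    using chi_la_eq_card_pendants[OF G _ la] by blast
  then show ?thesis
    using conn cV not_is_K2[OF cV] P by (intro exI[of _ V] exI[of _ E]) simp
qed

text \<open>With two colors and one pendant, the pendant edge must get the largest label \<open>m\<close>, the other
  vertices of its side have degree 2 with labels \<open>i\<close> and \<open>m - i\<close>, and the other side needs a
  constant sum. The least solution is \<open>m = 7\<close>, with \<open>7 + 1 + 2 + 4 = 6 + 5 + 3\<close>. In this numbering
  the edge \<open>{0, i}\<close> has label \<open>i\<close> and \<open>{8, i}\<close> has label \<open>7 - i = 15 - (8 + i)\<close>.\<close>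

lemma sharp_one_pendant:
  "\<exists>(V :: nat set) E. connected_graph V E \<and> card V \<ge> 3 \<and> card (pendants V E) = 1
    \<and> \<not> is_K2 V E \<and> chi_la V E = enat (1 + 1)"
proof -
  \<comment> \<open>The sides of \<open>K\<^sub>2\<^sub>,\<^sub>3\<close> are \<open>{0, 8}\<close>
    and \<open>{1, 2, 4}\<close>; the pendant \<open>7\<close> hangs on \<open>0\<close>. The color
    classes will be \<open>{0, 8}\<close> and \<open>{1, 2, 4, 7}\<close>.\<close>
  define V :: "nat set" where "V = {0, 1, 2, 4, 7, 8}"
  define E :: "nat set set" where
    "E = {{0, 1}, {0, 2}, {0, 4}, {0, 7}, {8, 1}, {8, 2}, {8, 4}}"
  define f :: "nat set \<Rightarrow> nat" where "f e = (if 8 \<in> e then 15 - \<Sum>e else \<Sum>e)" for e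
  have G: "simple_graph V E"
    by (rule simple_graphI) (auto simp: V_def E_def)
  have cV: "card V \<ge> 3"
    by (simp add: V_def)
  have cE: "card E = 7"
    by (simp add: E_def doubleton_eq_iff)
  have conn: "connected_graph V E"
  proof (rule connected_graphI[OF G])
    \<comment> \<open>Apart from \<open>0\<close> itself, \<open>8\<close> is the only vertex not
      adjacent to \<open>0\<close>; it is reached through \<open>1\<close>.\<close>
    have "{0, 1} \<in> E" "{1, 8} \<in> E"
      by (auto simp: E_def)
    then have "(0, 8) \<in> {(x, y). {x, y} \<in> E}\<^sup>*"
      by (intro rtrancl_trans[OF r_into_rtrancl r_into_rtrancl, of 0 1]) auto
    then show "(0, v) \<in> {(x, y). {x, y} \<in> E}\<^sup>*" if "v \<in> V" for v
      using that by (auto simp: V_def E_def)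
  qed (simp add: V_def)
  have inc:
    "incident_edges E 0 = {{0, 1}, {0, 2}, {0, 4}, {0, 7}}"
    "incident_edges E 1 = {{0, 1}, {8, 1}}"
    "incident_edges E 2 = {{0, 2}, {8, 2}}"
    "incident_edges E 4 = {{0, 4}, {8, 4}}"
    "incident_edges E 7 = {{0, 7}}"
    "incident_edges E 8 = {{8, 1}, {8, 2}, {8, 4}}"
    by (simp_all add: E_def incident_edges_empty incident_edges_insert)
  have P: "pendants V E = {7}"
  proof -
    have "vertex_degree E 0 = 4" "vertex_degree E 1 = 2" "vertex_degree E 2 = 2"
      "vertex_degree E 4 = 2" "vertex_degree E 7 = 1" "vertex_degree E 8 = 3"
      unfolding vertex_degree_def inc by (simp_all add: doubleton_eq_iff)
    then show ?thesis
      unfolding pendants_def V_def by auto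
  qed
  have color:
    "induced_color E f 0 = 14" "induced_color E f 1 = 7" "induced_color E f 2 = 7"
    "induced_color E f 4 = 7" "induced_color E f 7 = 7" "induced_color E f 8 = 14"
    unfolding induced_color_def inc by (simp_all add: doubleton_eq_iff f_def)
  have image: "f ` E = {1..7}"
  proof -
    have "f ` E = {1, 2, 4, 7, 6, 5, 3}"
      unfolding E_def by (simp add: f_def numeral_2_eq_2)
    also have "\<dots> = {1..7}"
      by auto
    finally show ?thesis .
  qed
  moreover have "inj_on f E"
    \<comment> \<open>Seven edges with seven different labels leave no room for a
      repetition.\<close>
    using image cE by (intro eq_card_imp_inj_on) (auto simp: E_def)
  ultimately have "bij_betw f E {1..7}"
    by (simp add: bij_betw_def)
  moreover have "induced_color E f u \<noteq> induced_color E f v" if "{u, v} \<in> E" for u v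
    using that color by (auto simp: E_def doubleton_eq_iff)
  ultimately have la: "local_antimagic V E f"
    by (simp add: local_antimagic_def cE)
  have "induced_color E f ` V = {14, 7}"
    unfolding V_def using color by auto
  then have "color_number V E f = 2"
    by (simp add: color_number_def)
  then have "color_number V E f \<le> card (pendants V E) + 1"
    by (simp add: P)
  moreover have "V \<noteq> {}"
    by (simp add: V_def)
  ultimately have "chi_la V E = enat (card (pendants V E) + 1)"
    using chi_la_eq_card_pendants[OF G _ la] by blast
  then show ?thesis
    using conn cV not_is_K2[OF cV] P by (intro exI[of _ V] exI[of _ E]) simp
qed

theorem theorem2p2:
  "(\<forall>(V :: 'a set) E k.
      connected_graph V E \<and> card V \<ge> 3 \<and> card (pendants V E) = k \<and> \<not> is_K2 V E
      \<longrightarrow> chi_la V E \<ge> enat (k + 1)) \<and>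
   (\<forall>k\<ge>1. \<exists>(V :: nat set) E.
      connected_graph V E \<and> card V \<ge> 3 \<and> card (pendants V E) = k \<and> \<not> is_K2 V E
      \<and> chi_la V E = enat (k + 1))"
proof (intro conjI allI impI)
  fix V :: "'a set" and E k
  assume "connected_graph V E \<and> card V \<ge> 3 \<and> card (pendants V E) = k \<and> \<not> is_K2 V E"
  then show "chi_la V E \<ge> enat (k + 1)"
    using chi_la_ge_card_pendants by (auto simp: connected_graph_def)
next
  fix k :: nat
  assume "k \<ge> 1"
  \<comment> \<open>The star with one leaf is \<open>K\<^sub>2\<close>, so \<open>k = 1\<close>
    requires a different graph.\<close>
  then consider "k = 1" | "k \<ge> 2"
    by linarith
  then show "\<exists>(V :: nat set) E.
      connected_graph V E \<and> card V \<ge> 3 \<and> card (pendants V E) = k \<and> \<not> is_K2 V E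
      \<and> chi_la V E = enat (k + 1)"
  proof cases
    case 1
    then show ?thesis
      using sharp_one_pendant by simp
  next
    case 2
    then show ?thesis
      by (rule sharp_star)
  qed
qed

end
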